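(* For every positive integer $n$ there is a one-one correspondence (bijection) between the set $DL_n$ of order-preserving partial transformations and the set of all (unrestricted) lattice paths in an $n\times n$ square.
   Context: A partial transformation of a finite chain $X$ is a map $\alpha:\mathrm{Dom}\,\alpha\to X$ with $\mathrm{Dom}\,\alpha\subseteq X$ (the empty map is allowed); it is order-preserving if $x\le y$ implies $x\alpha\le y\alpha$ for all $x,y\in\mathrm{Dom}\,\alpha$, where $x\alpha$ denotes the image of $x$. $DL_n$ is the set of all order-preserving partial transformations $\alpha$ of the chain $\{0,1,\ldots,n\}$ such that $\mathrm{Dom}\,\alpha\subseteq\{0,1,\ldots,n-1\}$. An (unrestricted) lattice path in an $n\times n$ square is a lattice path in the Cartesian plane that starts at $(0,0)$, ends at $(n,n)$, and is composed only of steps $(1,0)$, $(0,1)$ and $(1,1)$; it may cross the line $y=x$. *)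

theory Defs
  imports Main "HOL-Library.Product_Plus"
begin

definition partial_transformations :: "'a::linorder set \<Rightarrow> ('a \<rightharpoonup> 'a) set" where
  "partial_transformations X = {\<alpha>. dom \<alpha> \<subseteq> X \<and> ran \<alpha> \<subseteq> X}"

definition order_preserving :: "('a::linorder \<rightharpoonup> 'a) \<Rightarrow> bool" where
  "order_preserving \<alpha> \<longleftrightarrow> mono_on (dom \<alpha>) (\<lambda>x. the (\<alpha> x))"

definition DL :: "nat \<Rightarrow> (nat \<rightharpoonup> nat) set" where
  "DL n = {\<alpha> \<in> partial_transformations {0..n}. order_preserving \<alpha> \<and> dom \<alpha> \<subseteq> {0..<n}}"

definition lattice_steps :: "(int \<times> int) set" where
  "lattice_steps = {(1, 0), (0, 1), (1, 1)}"

(* A path is the list of the points it visits. It stays inside the square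
   because no step decreases a coordinate. *)
definition lattice_paths :: "nat \<Rightarrow> (int \<times> int) list set" where
  "lattice_paths n = {p. p \<noteq> [] \<and> hd p = (0, 0) \<and> last p = (int n, int n) \<and>
     successively (\<lambda>u v. v - u \<in> lattice_steps) p}"

end

theory Submission
  imports Defs "HOL-Library.Multiset"
begin

text \<open>
  Both sets are in bijection with the pairs \<open>(S, M)\<close> of a set \<open>S \<subseteq> {0..<n}\<close> and a multiset \<open>M\<close>
  over \<open>{0..n}\<close> with as many elements, counted with multiplicity, as \<open>S\<close>.

  An order-preserving partial transformation is determined by its domain \<open>S\<close> and the multiset
  \<open>M\<close> of its values, because the values have to be assigned to the points of the domain in
  increasing order; conversely, matching a set and a multiset of equal size in increasing order
  gives an order-preserving map (\<open>bij_betw_DL_column_data\<close>).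

  A lattice path crosses each of the columns \<open>[x, x + 1]\<close> with \<open>x < n\<close> by exactly one step, which is
  east or diagonal, and climbs each of the vertical lines \<open>x = 0, \<dots>, n\<close> by some number of north
  steps. It is therefore determined by the set \<open>S\<close> of the columns that it crosses by an east step
  and the multiset \<open>M\<close> of the abscissae of its north steps, and these can be prescribed freely
  as long as the path ends at the right height. The final height is the number \<open>size M\<close> of north
  steps plus the number \<open>n - card S\<close> of diagonal steps, so it is \<open>n\<close> exactly if
  \<open>size M = card S\<close> (\<open>bij_betw_paths_column_data\<close>).

  Under the resulting correspondence, column \<open>x\<close> is crossed by an east step iff \<open>x\<close> lies in the
  domain of the transformation, and line \<open>v\<close> is climbed by as many north steps as \<open>v\<close> has
  preimages.
\<close>

definition column_data :: "nat \<Rightarrow> (nat set \<times> nat multiset) set" where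
  "column_data n = {(S, M). S \<subseteq> {0..<n} \<and> set_mset M \<subseteq> {0..n} \<and> size M = card S}"

section \<open>Order-preserving maps from their domains and values\<close>

definition graph_data :: "('a \<rightharpoonup> 'b) \<Rightarrow> 'a set \<times> 'b multiset" where
  "graph_data \<alpha> = (dom \<alpha>, image_mset (\<lambda>x. the (\<alpha> x)) (mset_set (dom \<alpha>)))"

text \<open>
  Listing the domain in increasing order lists the values in increasing order as well, and a
  sorted list is determined by its multiset. Hence the data determine the map.
\<close>

lemma order_preserving_values_sorted:
  fixes \<alpha> :: "'a::linorder \<rightharpoonup> 'a"
  assumes fin: "finite (dom \<alpha>)" and "order_preserving \<alpha>"
  shows "map (\<lambda>x. the (\<alpha> x)) (sorted_list_of_set (dom \<alpha>)) =
    sorted_list_of_multiset (snd (graph_data \<alpha>))"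
proof -
  let ?xs = "sorted_list_of_set (dom \<alpha>)"
  have mono: "mono_on (set ?xs) (\<lambda>x. the (\<alpha> x))"
    using assms by (simp add: order_preserving_def)
  have "sorted (map (\<lambda>x. the (\<alpha> x)) ?xs)"
    unfolding sorted_map
    by (rule sorted_wrt_mono_rel[OF _ sorted_sorted_list_of_set]) (use mono in \<open>auto dest: mono_onD\<close>)
  moreover have "mset (map (\<lambda>x. the (\<alpha> x)) ?xs) = snd (graph_data \<alpha>)"
    by (simp add: graph_data_def flip: sorted_list_of_mset_set)
  ultimately show ?thesis
    by (metis sorted_list_of_multiset_mset sorted_sort_id)
qed

lemma order_preserving_eqI:
  fixes \<alpha> \<beta> :: "'a::linorder \<rightharpoonup> 'a"
  assumes "finite (dom \<alpha>)" "order_preserving \<alpha>" "order_preserving \<beta>"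
    and eq: "graph_data \<alpha> = graph_data \<beta>"
  shows "\<alpha> = \<beta>"
proof
  fix x
  have dom: "dom \<beta> = dom \<alpha>"
    using eq by (simp add: graph_data_def)
  have "map (\<lambda>x. the (\<alpha> x)) (sorted_list_of_set (dom \<alpha>)) =
      map (\<lambda>x. the (\<beta> x)) (sorted_list_of_set (dom \<alpha>))"
    using order_preserving_values_sorted[of \<alpha>] order_preserving_values_sorted[of \<beta>] assms dom
    by simp
  hence "\<forall>x\<in>dom \<alpha>. the (\<alpha> x) = the (\<beta> x)"
    using assms(1) by simp
  thus "\<alpha> x = \<beta> x"
    using dom by (metis domIff option.expand)
qed

text \<open>The witness pairs the elements of \<open>S\<close> and of \<open>M\<close>, both listed in increasing order.\<close>

lemma order_preserving_with_graph_data: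
  fixes S :: "'a::linorder set"
  assumes fin: "finite S" and size: "size M = card S"
  obtains \<alpha> where "order_preserving \<alpha>" "graph_data \<alpha> = (S, M)" "ran \<alpha> = set_mset M"
proof
  define xs ys where "xs = sorted_list_of_set S" and "ys = sorted_list_of_multiset M"
  define \<alpha> where "\<alpha> = map_of (zip xs ys)"
  have len: "length xs = length ys"
    using fin size by (metis mset_sorted_list_of_multiset size_mset
        sorted_list_of_set.length_sorted_key_list_of_set xs_def ys_def)
  have dist: "distinct xs" and setxs: "set xs = S" and sorted: "sorted xs" "sorted ys"
    and msets: "mset xs = mset_set S" "mset ys = M"
    using fin by (simp_all add: xs_def ys_def)
      (metis mset_sorted_list_of_multiset sorted_list_of_mset_set)
  have dom: "dom \<alpha> = S"
    using len setxs by (simp add: \<alpha>_def)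
  have nth: "\<alpha> (xs ! i) = Some (ys ! i)" if "i < length xs" for i
    using len dist that by (simp add: \<alpha>_def map_of_zip_nth)
  have map: "map (\<lambda>x. the (\<alpha> x)) xs = ys"
    using len nth by (auto intro: nth_equalityI)
  show "graph_data \<alpha> = (S, M)"
    using msets map dom by (metis graph_data_def mset_map)
  show "ran \<alpha> = set_mset M"
    using len dist msets(2) by (simp add: \<alpha>_def ran_map_of_zip flip: set_mset_mset)
  show "order_preserving \<alpha>"
    unfolding order_preserving_def
  proof (rule mono_onI)
    fix a b assume ab: "a \<in> dom \<alpha>" "b \<in> dom \<alpha>" "a \<le> b"
    then obtain i j where ij: "i < length xs" "a = xs ! i" "j < length xs" "b = xs ! j"
      using dom setxs by (metis in_set_conv_nth)
    have "i \<le> j"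
    proof (rule ccontr)
      assume "\<not> i \<le> j"
      hence "b \<le> a" and "i \<noteq> j"
        using ij sorted(1) by (auto intro: sorted_nth_mono)
      thus False
        using ab ij dist nth_eq_iff_index_eq by fastforce
    qed
    thus "the (\<alpha> a) \<le> the (\<alpha> b)"
      using ij nth len sorted(2) by (simp add: sorted_nth_mono)
  qed
qed

lemma bij_betw_DL_column_data: "bij_betw graph_data (DL n) (column_data n)"
proof (rule bij_betw_imageI)
  show "inj_on graph_data (DL n)"
    by (rule inj_onI) (auto simp: DL_def intro: order_preserving_eqI finite_subset)
  show "graph_data ` DL n = column_data n"
  proof (intro equalityI subsetI)
    fix c assume "c \<in> graph_data ` DL n"
    then obtain \<alpha> where \<alpha>: "c = graph_data \<alpha>" "dom \<alpha> \<subseteq> {0..<n}" "ran \<alpha> \<subseteq> {0..n}"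
      by (auto simp: DL_def partial_transformations_def)
    have "finite (dom \<alpha>)"
      using \<alpha>(2) finite_subset by blast
    thus "c \<in> column_data n"
      using \<alpha> by (auto simp: column_data_def graph_data_def ran_def subset_iff)
  next
    fix c assume "c \<in> column_data n"
    then obtain S M where c: "c = (S, M)" "S \<subseteq> {0..<n}" "set_mset M \<subseteq> {0..n}" "size M = card S"
      by (auto simp: column_data_def)
    then obtain \<alpha> where \<alpha>: "order_preserving \<alpha>" "graph_data \<alpha> = (S, M)" "ran \<alpha> = set_mset M"
      using order_preserving_with_graph_data finite_subset by (metis finite_atLeastLessThan)
    hence "dom \<alpha> = S"
      by (simp add: graph_data_def)
    hence "\<alpha> \<in> DL n"
      using \<alpha> c by (force simp: DL_def partial_transformations_def)
    thus "c \<in> graph_data ` DL n"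
      using \<alpha> c by (metis image_eqI)
  qed
qed

section \<open>Lattice paths from their east and north steps\<close>

text \<open>
  The paths from an arbitrary point to \<open>(n, n)\<close>. The abscissa is a natural number, like the points
  that a transformation acts on. The ordinate stays an integer and may be negative, so that
  every pair of a set and a multiset comes from a path that starts at a suitable height.
\<close>

inductive path_to :: "nat \<Rightarrow> nat \<Rightarrow> int \<Rightarrow> (int \<times> int) list \<Rightarrow> bool" for n where
  stop: "path_to n n (int n) [(int n, int n)]"
| east: "path_to n (Suc x) y p \<Longrightarrow> path_to n x y ((int x, y) # p)"
| north: "path_to n x (y + 1) p \<Longrightarrow> path_to n x y ((int x, y) # p)"
| diagonal: "path_to n (Suc x) (y + 1) p \<Longrightarrow> path_to n x y ((int x, y) # p)"

fun east_columns :: "(int \<times> int) list \<Rightarrow> nat set" where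
  "east_columns (u # v # p) =
    (if v - u = (1, 0) then {nat (fst u)} else {}) \<union> east_columns (v # p)"
| "east_columns _ = {}"

fun north_lines :: "(int \<times> int) list \<Rightarrow> nat multiset" where
  "north_lines (u # v # p) =
    (if v - u = (0, 1) then {#nat (fst u)#} else {#}) + north_lines (v # p)"
| "north_lines _ = {#}"

definition path_data :: "(int \<times> int) list \<Rightarrow> nat set \<times> nat multiset" where
  "path_data p = (east_columns p, north_lines p)"

lemma path_to_Cons: "path_to n x y p \<Longrightarrow> \<exists>q. p = (int x, y) # q"
  by (auto elim: path_to.cases)

lemma path_data_step:
  "path_to n (Suc x) y p \<Longrightarrow> east_columns ((int x, y) # p) = insert x (east_columns p)"
  "path_to n (Suc x) y p \<Longrightarrow> north_lines ((int x, y) # p) = north_lines p"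
  "path_to n x (y + 1) p \<Longrightarrow> east_columns ((int x, y) # p) = east_columns p"
  "path_to n x (y + 1) p \<Longrightarrow> north_lines ((int x, y) # p) = add_mset x (north_lines p)"
  "path_to n (Suc x) (y + 1) p \<Longrightarrow> east_columns ((int x, y) # p) = east_columns p"
  "path_to n (Suc x) (y + 1) p \<Longrightarrow> north_lines ((int x, y) # p) = north_lines p"
  by (auto dest!: path_to_Cons)

lemma lattice_paths_conv_path_to: "p \<in> lattice_paths n \<longleftrightarrow> path_to n 0 0 p"
proof
  have "path_to n x y p"
    if "p \<noteq> []" "hd p = (int x, y)" "last p = (int n, int n)"
      "successively (\<lambda>u v. v - u \<in> lattice_steps) p" for x y
    using that
  proof (induction p arbitrary: x y)
    case (Cons u p)
    show ?case
    proof (cases p)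
      case Nil
      with Cons.prems show ?thesis
        by (auto intro: stop)
    next
      case (Cons v q)
      with Cons.prems have "v - (int x, y) \<in> lattice_steps" and u: "u = (int x, y)"
        by auto
      then consider "v = (int (Suc x), y)" | "v = (int x, y + 1)" | "v = (int (Suc x), y + 1)"
        by (cases v) (auto simp: lattice_steps_def algebra_simps)
      thus ?thesis
        using Cons.IH[of "Suc x" y] Cons.IH[of x "y + 1"] Cons.IH[of "Suc x" "y + 1"] Cons.prems Cons
        by cases (auto simp: u intro: east north diagonal)
    qed
  qed simp
  thus "p \<in> lattice_paths n \<Longrightarrow> path_to n 0 0 p"
    by (simp add: lattice_paths_def)
next
  have "p \<noteq> [] \<and> hd p = (int x, y) \<and> last p = (int n, int n) \<and>
      successively (\<lambda>u v. v - u \<in> lattice_steps) p" if "path_to n x y p" for x y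
    using that
    by induction (auto simp: successively_Cons lattice_steps_def)
  from this[of 0 0] show "path_to n 0 0 p \<Longrightarrow> p \<in> lattice_paths n"
    by (simp add: lattice_paths_def)
qed

text \<open>
  The last claim computes the remaining height \<open>n - y\<close> as the number of north steps plus the
  number \<open>(n - x) - card (east_columns p)\<close> of diagonal steps.
\<close>

lemma path_data_bounds:
  assumes "path_to n x y p"
  shows "x \<le> n" "east_columns p \<subseteq> {x..<n}" "set_mset (north_lines p) \<subseteq> {x..n}"
    "int (size (north_lines p)) + int n - int x - int (card (east_columns p)) = int n - y"
proof -
  have "x \<le> n \<and> east_columns p \<subseteq> {x..<n} \<and> set_mset (north_lines p) \<subseteq> {x..n} \<and>
    int (size (north_lines p)) + int n - int x - int (card (east_columns p)) = int n - y"
    using assms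
  proof induction
    case (east x y p)
    hence "x \<notin> east_columns p" "finite (east_columns p)"
      by (auto dest: finite_subset)
    with east show ?case
      by (auto simp: path_data_step)
  qed (auto simp: path_data_step)
  thus "x \<le> n" "east_columns p \<subseteq> {x..<n}" "set_mset (north_lines p) \<subseteq> {x..n}"
    "int (size (north_lines p)) + int n - int x - int (card (east_columns p)) = int n - y"
    by blast+
qed

text \<open>
  The data reveal the first step of a path from abscissa \<open>x\<close>: it is a north step iff \<open>x\<close> occurs in
  the multiset, since every step after the crossing of column \<open>x\<close> starts further to the right;
  otherwise it is an east step iff \<open>x\<close> belongs to the set.
\<close>

lemma path_to_eqI:
  assumes "path_to n x y p" "path_to n x y q" "path_data p = path_data q"
  shows "p = q"
  using assms
proof (induction arbitrary: q)
  case stop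
  from stop.prems(1) show ?case
  proof cases
    case (north r)
    with stop.prems(2) show ?thesis
      by (simp add: path_data_def path_data_step)
  qed (auto dest: path_data_bounds(1))
next
  case (east x y p)
  from east.prems(1) show ?case
  proof cases
    case (east r)
    have "x \<notin> east_columns p" "x \<notin> east_columns r"
      using path_data_bounds(2)[OF east.hyps] path_data_bounds(2)[OF east(2)] by auto
    with east east.hyps east.prems(2) east.IH[of r] show ?thesis
      by (simp add: path_data_def path_data_step insert_ident)
  next
    case (north r)
    have "x \<notin># north_lines p"
      using path_data_bounds(3)[OF east.hyps] by auto
    with north east.hyps east.prems(2) show ?thesis
      by (auto simp: path_data_def path_data_step)
  next
    case (diagonal r)
    have "x \<notin> east_columns r"
      using path_data_bounds(2)[OF diagonal(2)] by auto
    with diagonal east.hyps east.prems(2) show ?thesis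
      by (auto simp: path_data_def path_data_step)
  qed (use east.hyps in \<open>auto dest: path_data_bounds(1)\<close>)
next
  case (north x y p)
  from north.prems(1) show ?case
  proof cases
    case (east r)
    have "x \<notin># north_lines r"
      using path_data_bounds(3)[OF east(2)] by auto
    hence "north_lines r \<noteq> add_mset x (north_lines p)"
      by (metis union_single_eq_member)
    with east north.hyps north.prems(2) show ?thesis
      by (auto simp: path_data_def path_data_step)
  next
    case (north r)
    with north.hyps north.prems(2) north.IH[of r] show ?thesis
      by (simp add: path_data_def path_data_step)
  next
    case (diagonal r)
    have "x \<notin># north_lines r"
      using path_data_bounds(3)[OF diagonal(2)] by auto
    hence "north_lines r \<noteq> add_mset x (north_lines p)"
      by (metis union_single_eq_member)
    with diagonal north.hyps north.prems(2) show ?thesis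
      by (auto simp: path_data_def path_data_step)
  qed (use north.hyps north.prems(2) in \<open>simp add: path_data_def path_data_step\<close>)
next
  case (diagonal x y p)
  from diagonal.prems(1) show ?case
  proof cases
    case (east r)
    have "x \<notin> east_columns p"
      using path_data_bounds(2)[OF diagonal.hyps] by auto
    with east diagonal.hyps diagonal.prems(2) show ?thesis
      by (auto simp: path_data_def path_data_step)
  next
    case (north r)
    have "x \<notin># north_lines p"
      using path_data_bounds(3)[OF diagonal.hyps] by auto
    with north diagonal.hyps diagonal.prems(2) show ?thesis
      by (auto simp: path_data_def path_data_step)
  next
    case (diagonal r)
    with diagonal.hyps diagonal.prems(2) diagonal.IH[of r] show ?thesis
      by (simp add: path_data_def path_data_step)
  qed (use diagonal.hyps in \<open>auto dest: path_data_bounds(1)\<close>)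
qed

text \<open>
  Conversely, data within the bounds are realised by following the steps that they dictate: climb
  the line \<open>x\<close> as long as \<open>x\<close> occurs in \<open>M\<close>, then cross column \<open>x\<close>. Each step decreases
  \<open>n - x + size M\<close>.
\<close>

lemma path_to_with_path_data:
  assumes "x \<le> n" "S \<subseteq> {x..<n}" "set_mset M \<subseteq> {x..n}"
    "int (size M) + int n - int x - int (card S) = int n - y"
  shows "\<exists>p. path_to n x y p \<and> path_data p = (S, M)"
  using assms
proof (induction "n - x + size M" arbitrary: x y S M rule: less_induct)
  case less
  have fin: "finite S"
    using less.prems(2) finite_subset by blast
  show ?case
  proof (cases "x \<in># M")
    case True
    then obtain M' where M: "M = add_mset x M'"
      by (metis mset_add)
    have "\<exists>p. path_to n x (y + 1) p \<and> path_data p = (S, M')"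
      by (rule less.hyps) (use less.prems M in auto)
    then obtain p where p: "path_to n x (y + 1) p" "path_data p = (S, M')"
      by blast
    hence "path_data ((int x, y) # p) = (S, M)"
      by (simp add: path_data_def path_data_step M)
    thus ?thesis
      using p(1) path_to.north by blast
  next
    case noN: False
    show ?thesis
    proof (cases "x = n")
      case True
      with noN less.prems have "S = {}" "M = {#}"
        by (auto simp: subset_iff)
      with True less.prems show ?thesis
        by (auto simp: path_data_def intro!: exI path_to.stop)
    next
      case False
      have M: "set_mset M \<subseteq> {Suc x..n}"
        using less.prems(3) noN by (force simp: subset_iff Suc_le_eq order.strict_iff_order)
      show ?thesis
      proof (cases "x \<in> S")
        case True
        then obtain S' where S: "S = insert x S'" "x \<notin> S'"
          by (meson Set.set_insert)
        have "\<exists>p. path_to n (Suc x) y p \<and> path_data p = (S', M)"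
          by (rule less.hyps)
            (use less.prems M S False fin in \<open>auto simp: subset_iff Suc_le_eq order.strict_iff_order\<close>)
        then obtain p where p: "path_to n (Suc x) y p" "path_data p = (S', M)"
          by blast
        hence "path_data ((int x, y) # p) = (S, M)"
          by (simp add: path_data_def path_data_step S)
        thus ?thesis
          using p(1) path_to.east by blast
      next
        case noE: False
        have "\<exists>p. path_to n (Suc x) (y + 1) p \<and> path_data p = (S, M)"
          by (rule less.hyps)
            (use less.prems M noE False in \<open>auto simp: subset_iff Suc_le_eq order.strict_iff_order\<close>)
        then obtain p where p: "path_to n (Suc x) (y + 1) p" "path_data p = (S, M)"
          by blast
        hence "path_data ((int x, y) # p) = (S, M)"
          by (simp add: path_data_def path_data_step)
        thus ?thesis
          using p(1) path_to.diagonal by blast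
      qed
    qed
  qed
qed

lemma bij_betw_paths_column_data: "bij_betw path_data (lattice_paths n) (column_data n)"
proof (rule bij_betw_imageI)
  show "inj_on path_data (lattice_paths n)"
    by (rule inj_onI) (auto simp: lattice_paths_conv_path_to intro: path_to_eqI)
  show "path_data ` lattice_paths n = column_data n"
  proof (intro equalityI subsetI)
    fix c assume "c \<in> path_data ` lattice_paths n"
    then obtain p where "c = path_data p" "path_to n 0 0 p"
      by (auto simp: lattice_paths_conv_path_to)
    thus "c \<in> column_data n"
      using path_data_bounds[of n 0 0 p] by (simp add: column_data_def path_data_def)
  next
    fix c assume "c \<in> column_data n"
    then obtain S M where c: "c = (S, M)" "S \<subseteq> {0..<n}" "set_mset M \<subseteq> {0..n}" "size M = card S"
      by (auto simp: column_data_def)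
    obtain p where "path_to n 0 0 p" "path_data p = c"
      using path_to_with_path_data[of 0 n S M 0] c by auto
    thus "c \<in> path_data ` lattice_paths n"
      by (auto simp: lattice_paths_conv_path_to)
  qed
qed

section \<open>The correspondence\<close>

theorem theorem3p9:
  fixes n :: nat
  assumes "n > 0"
  shows "\<exists>f. bij_betw f (DL n) (lattice_paths n)"
  using bij_betw_trans[OF bij_betw_DL_column_data bij_betw_inv_into[OF bij_betw_paths_column_data]]
  by blast

end
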